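(* Let $\{X_t\}_{t\ge 0}$ be a stationary stochastic process with values in a finite set $\{\beta_0,\ldots,\beta_{L-1}\}$ of $L$ elements. Then its predictability gain satisfies $$0\le \mathcal{G}_u\le \ln(L)\qquad\text{for all integers } u\ge 0.$$
   Context: For $r\ge1$, $p(\beta_{i_1},\ldots,\beta_{i_r})$ denotes the probability that $r$ consecutive values of the process are $\beta_{i_1},\ldots,\beta_{i_r}$ in temporal order (independent of the starting time by stationarity). The block entropy of size $r\ge 1$ is $H_r=-\sum_{i_1,\ldots,i_r=0}^{L-1}p(\beta_{i_1},\ldots,\beta_{i_r})\ln p(\beta_{i_1},\ldots,\beta_{i_r})$ (with $0\ln 0=0$), and $H_0=0$. The predictability gain is, for integer $u\ge 0$, $$\mathcal{G}_u=-(H_{u+2}-2H_{u+1}+H_u).$$ *)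

theory Defs
  imports "HOL-Probability.Probability"
begin

text \<open>
  Strict stationarity of a discrete-time process with state space \<open>N\<close>: for any finitely many times,
  the joint distribution is unchanged when all the times are shifted by \<open>s\<close>.
\<close>

definition stationary_process :: "'w measure \<Rightarrow> 'b measure \<Rightarrow> (nat \<Rightarrow> 'w \<Rightarrow> 'b) \<Rightarrow> bool" where
  "stationary_process M N X \<longleftrightarrow>
     (\<forall>t. X t \<in> measurable M N) \<and>
     (\<forall>J s. finite J \<longrightarrow>
        distr M (Pi\<^sub>M J (\<lambda>_. N)) (\<lambda>\<omega>. \<lambda>t\<in>J. X (t + s) \<omega>) =
        distr M (Pi\<^sub>M J (\<lambda>_. N)) (\<lambda>\<omega>. \<lambda>t\<in>J. X t \<omega>))"

text \<open>
  Only the values of \<open>x\<close> below \<open>r\<close> matter. The block starts at time \<open>0\<close>; by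
  \<open>block_prob_shift\<close> below the starting time is irrelevant for a stationary process.
\<close>

definition block_prob :: "'w measure \<Rightarrow> (nat \<Rightarrow> 'w \<Rightarrow> 'b) \<Rightarrow> nat \<Rightarrow> (nat \<Rightarrow> 'b) \<Rightarrow> real" where
  "block_prob M X r x = measure M {\<omega> \<in> space M. \<forall>k<r. X k \<omega> = x k}"

text \<open>
  The tuples \<open>(i\<^sub>1, \<dots>, i\<^sub>r)\<close> of indices are the extensional functions from \<open>{..<r}\<close> to \<open>{..<L}\<close>.
  The convention \<open>0 ln 0 = 0\<close> holds automatically.
\<close>

definition block_entropy ::
    "'w measure \<Rightarrow> (nat \<Rightarrow> 'w \<Rightarrow> 'b) \<Rightarrow> (nat \<Rightarrow> 'b) \<Rightarrow> nat \<Rightarrow> nat \<Rightarrow> real" where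
  "block_entropy M X \<beta> L r =
     (if r = 0 then 0
      else - (\<Sum>i\<in>{..<r} \<rightarrow>\<^sub>E {..<L}.
                block_prob M X r (\<lambda>k. \<beta> (i k)) * ln (block_prob M X r (\<lambda>k. \<beta> (i k)))))"

definition predictability_gain ::
    "'w measure \<Rightarrow> (nat \<Rightarrow> 'w \<Rightarrow> 'b) \<Rightarrow> (nat \<Rightarrow> 'b) \<Rightarrow> nat \<Rightarrow> nat \<Rightarrow> real" where
  "predictability_gain M X \<beta> L u =
     - (block_entropy M X \<beta> L (u + 2) - 2 * block_entropy M X \<beta> L (u + 1) + block_entropy M X \<beta> L u)"

lemma block_prob_shift:
  assumes "stationary_process M (count_space S) X"
  shows "measure M {\<omega> \<in> space M. \<forall>k<r. X (k + s) \<omega> = x k} = block_prob M X r x"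
proof -
  let ?P = "Pi\<^sub>M {..<r} (\<lambda>_. count_space S)"
  let ?A = "{f \<in> space ?P. \<forall>k<r. f k = x k}"
  have X [measurable]: "X t \<in> measurable M (count_space S)" for t
    using assms(1) by (simp add: stationary_process_def)
  have m: "(\<lambda>\<omega>. \<lambda>t\<in>{..<r}. X (t + s) \<omega>) \<in> measurable M ?P" for s
    by measurable
  have A: "?A \<in> sets ?P"
  proof -
    have "?A = Pi\<^sub>E {..<r} (\<lambda>k. S \<inter> {x k})"
      by (auto simp: space_PiM PiE_def Pi_def)
    also have "\<dots> \<in> sets ?P"
      by (rule sets_PiM_I_finite) auto
    finally show ?thesis .
  qed
  have eq: "measure (distr M ?P (\<lambda>\<omega>. \<lambda>t\<in>{..<r}. X (t + s) \<omega>)) ?A =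
        measure M {\<omega> \<in> space M. \<forall>k<r. X (k + s) \<omega> = x k}" for s
    unfolding measure_distr[OF m A]
    using measurable_space[OF m]
    by (intro arg_cong[where f = "measure M"]) auto
  have "distr M ?P (\<lambda>\<omega>. \<lambda>t\<in>{..<r}. X (t + s) \<omega>) = distr M ?P (\<lambda>\<omega>. \<lambda>t\<in>{..<r}. X (t + 0) \<omega>)"
    using assms(1) by (simp add: stationary_process_def)
  then show ?thesis
    using eq[of s] eq[of 0] by (simp add: block_prob_def)
qed

end

theory Submission
  imports Defs
begin

text \<open>
  With \<open>h\<^sub>u = H\<^sub>u\<^sub>+\<^sub>1 - H\<^sub>u\<close> the predictability gain is \<open>h\<^sub>u - h\<^sub>u\<^sub>+\<^sub>1\<close>.
  By stationarity it is the mutual information between the first and the last letter of a block of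
  length \<open>u + 2\<close> conditioned on the \<open>u\<close> letters in between, hence nonnegative.
  For the upper bound, \<open>h\<^sub>u \<le> ln L\<close> as the entropy of one letter given the preceding ones,
  and \<open>h\<^sub>u\<^sub>+\<^sub>1 \<ge> 0\<close>. Everything reduces to \<open>x ln (x / y) \<ge> x - y\<close>.
\<close>

section \<open>Entropy inequalities for finite families of nonnegative reals\<close>

lemma mult_ln_diff_ge:
  fixes x y :: real
  assumes "0 < x" "0 < y"
  shows "x - y \<le> x * (ln x - ln y)"
proof -
  have "ln (y / x) \<le> y / x - 1"
    using assms by (intro ln_le_minus_one) simp
  then have "x * ln (y / x) \<le> x * (y / x - 1)"
    using assms by (intro mult_left_mono) auto
  then show ?thesis
    using assms by (simp add: ln_div algebra_simps)
qed

text \<open>Nonnegativity of mutual information, obtained by comparing \<open>f\<close> with the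
  product \<open>R a * C b / S\<close> of its marginals, which has the same mass. The mass
  \<open>S\<close> is left arbitrary because the lemma is applied with the middle word fixed, and
  \<open>S\<close> is then the probability of that word.\<close>

lemma sum_mult_ln_le_joint:
  fixes f :: "'a \<Rightarrow> 'b \<Rightarrow> real"
  assumes "finite A" "finite B" and nonneg: "\<And>a b. a \<in> A \<Longrightarrow> b \<in> B \<Longrightarrow> 0 \<le> f a b"
  defines "R \<equiv> \<lambda>a. \<Sum>b\<in>B. f a b" and "C \<equiv> \<lambda>b. \<Sum>a\<in>A. f a b" and "S \<equiv> \<Sum>a\<in>A. \<Sum>b\<in>B. f a b"
  shows "(\<Sum>a\<in>A. R a * ln (R a)) + (\<Sum>b\<in>B. C b * ln (C b))
           \<le> (\<Sum>a\<in>A. \<Sum>b\<in>B. f a b * ln (f a b)) + S * ln S"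
proof -
  have S_R: "S = sum R A" by (simp add: S_def R_def)
  have S_C: "S = sum C B" unfolding S_def C_def by (rule sum.swap)
  have R_nonneg: "0 \<le> R a" if "a \<in> A" for a
    using that nonneg by (auto simp: R_def intro: sum_nonneg)
  have C_nonneg: "0 \<le> C b" if "b \<in> B" for b
    using that nonneg by (auto simp: C_def intro: sum_nonneg)
  have S_nonneg: "0 \<le> S" unfolding S_R by (intro sum_nonneg R_nonneg)
  have pointwise: "f a b - R a * C b / S \<le> f a b * (ln (f a b) + ln S - ln (R a) - ln (C b))"
    if ab: "a \<in> A" "b \<in> B" for a b
  proof (cases "f a b = 0")
    case True
    then show ?thesis using R_nonneg[OF ab(1)] C_nonneg[OF ab(2)] S_nonneg by simp
  next
    case False
    then have f: "0 < f a b" using nonneg[OF ab] by simp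
    have "f a b \<le> R a" unfolding R_def
      using ab assms(2) nonneg by (intro member_le_sum) auto
    moreover have "f a b \<le> C b" unfolding C_def
      using ab assms(1) nonneg by (intro member_le_sum[of a A "\<lambda>a. f a b"]) auto
    moreover have "R a \<le> S" unfolding S_R
      using ab assms(1) R_nonneg by (intro member_le_sum) auto
    ultimately have pos: "0 < R a" "0 < C b" "0 < S" using f by auto
    then have "ln (f a b) + ln S - ln (R a) - ln (C b) = ln (f a b) - ln (R a * C b / S)"
      by (simp add: ln_div ln_mult)
    then show ?thesis
      using mult_ln_diff_ge[OF f, of "R a * C b / S"] pos by (simp only: divide_pos_pos mult_pos_pos)
  qed
  have "(\<Sum>a\<in>A. \<Sum>b\<in>B. R a * C b / S) = sum R A * sum C B / S"
    by (simp add: sum_product sum_divide_distrib)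
  \<comment> \<open>Both marginals have mass \<open>S\<close>, so the value is
    \<open>S * S / S\<close>. For \<open>S = 0\<close> this is still \<open>S\<close>, as division
    by zero yields 0.\<close>
  also have "\<dots> = S"
    by (simp flip: S_R S_C)
  finally have "0 = (\<Sum>a\<in>A. \<Sum>b\<in>B. f a b - R a * C b / S)"
    by (simp add: sum_subtractf flip: S_def)
  also have "\<dots> \<le> (\<Sum>a\<in>A. \<Sum>b\<in>B. f a b * (ln (f a b) + ln S - ln (R a) - ln (C b)))"
    by (intro sum_mono pointwise)
  also have "\<dots> = (\<Sum>a\<in>A. \<Sum>b\<in>B. f a b * ln (f a b)) + (\<Sum>a\<in>A. \<Sum>b\<in>B. f a b * ln S)
      - (\<Sum>a\<in>A. \<Sum>b\<in>B. f a b * ln (R a)) - (\<Sum>a\<in>A. \<Sum>b\<in>B. f a b * ln (C b))"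
    by (simp add: algebra_simps sum.distrib sum_subtractf)
  also have "(\<Sum>a\<in>A. \<Sum>b\<in>B. f a b * ln S) = S * ln S"
    by (simp add: S_def sum_distrib_right)
  also have "(\<Sum>a\<in>A. \<Sum>b\<in>B. f a b * ln (R a)) = (\<Sum>a\<in>A. R a * ln (R a))"
    by (simp add: R_def sum_distrib_right)
  also have "(\<Sum>a\<in>A. \<Sum>b\<in>B. f a b * ln (C b)) = (\<Sum>b\<in>B. C b * ln (C b))"
    by (subst sum.swap) (simp add: C_def sum_distrib_right)
  finally show ?thesis by simp
qed

text \<open>The uniform distribution maximises entropy: \<open>c\<close> is compared with the
  constant family \<open>S / n\<close> of the same mass. Again the mass is not normalised, so that
  \<open>c\<close> can be the family of probabilities of the one-letter extensions of a
  word.\<close>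

lemma sum_mult_ln_ge_uniform:
  fixes c :: "'a \<Rightarrow> real"
  assumes "finite B" and nonneg: "\<And>b. b \<in> B \<Longrightarrow> 0 \<le> c b"
  shows "sum c B * ln (sum c B) \<le> (\<Sum>b\<in>B. c b * ln (c b)) + sum c B * ln (real (card B))"
proof (cases "B = {}")
  case False
  define S where "S = sum c B"
  define n where "n = real (card B)"
  have n: "0 < n" using False assms(1) by (simp add: n_def card_gt_0_iff)
  have S_nonneg: "0 \<le> S" unfolding S_def by (intro sum_nonneg nonneg)
  have pointwise: "c b - S / n \<le> c b * (ln (c b) + ln n - ln S)" if b: "b \<in> B" for b
  proof (cases "c b = 0")
    case True
    then show ?thesis using S_nonneg n by simp
  next
    case False
    then have c: "0 < c b" using nonneg[OF b] by simp
    moreover have "c b \<le> S" unfolding S_def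
      using b assms(1) nonneg by (intro member_le_sum) auto
    ultimately have "0 < S" by simp
    then show ?thesis
      using mult_ln_diff_ge[OF c, of "S / n"] n by (simp add: ln_div algebra_simps)
  qed
  have "0 = (\<Sum>b\<in>B. c b - S / n)"
    using n by (simp add: sum_subtractf flip: S_def n_def)
  also have "\<dots> \<le> (\<Sum>b\<in>B. c b * (ln (c b) + ln n - ln S))"
    by (intro sum_mono pointwise)
  also have "\<dots> = (\<Sum>b\<in>B. c b * ln (c b)) + S * ln n - S * ln S"
    by (simp add: S_def ring_distribs sum.distrib sum_subtractf sum_distrib_right)
  finally show ?thesis by (simp add: S_def n_def)
qed simp

lemma sum_mult_ln_le_sum:
  fixes c :: "'a \<Rightarrow> real"
  assumes "finite B" and nonneg: "\<And>b. b \<in> B \<Longrightarrow> 0 \<le> c b"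
  shows "(\<Sum>b\<in>B. c b * ln (c b)) \<le> sum c B * ln (sum c B)"
  unfolding sum_distrib_right
proof (rule sum_mono)
  fix b assume b: "b \<in> B"
  have "c b \<le> sum c B"
    using b assms by (intro member_le_sum) auto
  \<comment> \<open>Monotonicity of \<open>ln\<close> needs a positive argument; for
    \<open>c b = 0\<close> both sides vanish.\<close>
  then show "c b * ln (c b) \<le> c b * ln (sum c B)"
    using nonneg[OF b] by (cases "c b = 0") (auto intro: mult_left_mono)
qed

section \<open>Splitting off the last or the first letter in sums over words\<close>

lemma sum_PiE_snoc:
  "(\<Sum>i\<in>{..<Suc r} \<rightarrow>\<^sub>E A. g i) = (\<Sum>i\<in>{..<r} \<rightarrow>\<^sub>E A. \<Sum>a\<in>A. g (i(r := a)))"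
proof -
  have "(\<Sum>i\<in>{..<Suc r} \<rightarrow>\<^sub>E A. g i) = (\<Sum>(i, a)\<in>({..<r} \<rightarrow>\<^sub>E A) \<times> A. g (i(r := a)))"
    by (rule sum.reindex_bij_witness
        \<comment> \<open>Removing the last letter must reset position \<open>r\<close> to
          \<open>undefined\<close>, since the prefix has to be extensional on
          \<open>{..<r}\<close>.\<close>
        [where i = "\<lambda>(i, a). i(r := a)" and j = "\<lambda>i. (i(r := undefined), i r)"])
       (auto simp: PiE_def Pi_def extensional_def fun_eq_iff less_Suc_eq)
  then show ?thesis by (simp add: sum.cartesian_product)
qed

lemma case_nat_eta: "case_nat (f 0) (\<lambda>k. f (Suc k)) = f"
  by (simp add: fun_eq_iff split: nat.split)

text \<open>Here \<open>case_nat a i\<close> is the word \<open>i\<close> moved one position to the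
  right with \<open>a\<close> placed in front; the shift \<open>\<lambda>k. i (Suc k)\<close> undoes
  it and preserves extensionality.\<close>

lemma sum_PiE_cons:
  "(\<Sum>i\<in>{..<Suc r} \<rightarrow>\<^sub>E A. g i) = (\<Sum>i\<in>{..<r} \<rightarrow>\<^sub>E A. \<Sum>a\<in>A. g (case_nat a i))"
proof -
  have "(\<Sum>i\<in>{..<Suc r} \<rightarrow>\<^sub>E A. g i) = (\<Sum>(i, a)\<in>({..<r} \<rightarrow>\<^sub>E A) \<times> A. g (case_nat a i))"
    by (rule sum.reindex_bij_witness
        [where i = "\<lambda>(i, a). case_nat a i" and j = "\<lambda>i. (\<lambda>k. i (Suc k), i 0)"])
       (auto simp: PiE_def Pi_def extensional_def case_nat_eta split: nat.splits)
  then show ?thesis by (simp add: sum.cartesian_product)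
qed

text \<open>Prepending and appending commute, the appended position moving from \<open>r\<close> to
  \<open>Suc r\<close>. A word can thus be built from its middle part in either order.\<close>

lemma case_nat_fun_upd: "case_nat a (i(r := b)) = (case_nat a i)(Suc r := b)"
  by (auto simp: fun_eq_iff split: nat.split)

section \<open>Word probabilities and their marginals\<close>

locale stationary_finite_process = prob_space M
  for M :: "'w measure" +
  fixes X :: "nat \<Rightarrow> 'w \<Rightarrow> 'b" and \<beta> :: "nat \<Rightarrow> 'b" and L :: nat
  assumes inj: "inj_on \<beta> {..<L}"
    and stationary: "stationary_process M (count_space (\<beta> ` {..<L})) X"
begin

definition word_prob :: "nat \<Rightarrow> (nat \<Rightarrow> nat) \<Rightarrow> real" where
  "word_prob r i = block_prob M X r (\<lambda>k. \<beta> (i k))"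

lemma word_prob_nonneg: "0 \<le> word_prob r i"
  by (simp add: word_prob_def block_prob_def)

lemma X_measurable [measurable]: "X t \<in> measurable M (count_space (\<beta> ` {..<L}))"
  using stationary by (simp add: stationary_process_def)

lemma X_in: "\<omega> \<in> space M \<Longrightarrow> X t \<omega> \<in> \<beta> ` {..<L}"
  using measurable_space[OF X_measurable] by simp

lemma X_eq_sets: "{\<omega> \<in> space M. X t \<omega> = x} \<in> sets M"
proof -
  have "{\<omega> \<in> space M. X t \<omega> = x} = X t -` ({x} \<inter> \<beta> ` {..<L}) \<inter> space M"
    using X_in by auto
  then show ?thesis
    using measurable_sets[OF X_measurable, of "{x} \<inter> \<beta> ` {..<L}" t] by simp
qed

lemma block_event_sets: "{\<omega> \<in> space M. \<forall>k<(r::nat). X (k + s) \<omega> = x k} \<in> sets M"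
proof -
  have "{\<omega> \<in> space M. \<forall>k\<in>{..<r}. X (k + s) \<omega> = x k} \<in> sets M"
    by (rule sets.sets_Collect_finite_All) (auto intro: X_eq_sets)
  then show ?thesis by (simp add: Ball_def)
qed

text \<open>The events on the left partition \<open>A\<close>: they cover it because every value of
  the process is some \<open>\<beta> a\<close>, and they are disjoint because \<open>\<beta>\<close>
  is injective.\<close>

lemma measure_split_value:
  assumes "A \<in> sets M"
  shows "(\<Sum>a<L. measure M {\<omega> \<in> A. X t \<omega> = \<beta> a}) = measure M A"
proof -
  have A: "\<omega> \<in> space M" if "\<omega> \<in> A" for \<omega>
    using assms that sets.sets_into_space by blast
  have "A = (\<Union>a\<in>{..<L}. {\<omega> \<in> A. X t \<omega> = \<beta> a})"
    using X_in A by blast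
  moreover have "measure M (\<Union>a\<in>{..<L}. {\<omega> \<in> A. X t \<omega> = \<beta> a})
      = (\<Sum>a<L. measure M {\<omega> \<in> A. X t \<omega> = \<beta> a})"
  proof (rule finite_measure_finite_Union)
    have "{\<omega> \<in> A. X t \<omega> = \<beta> a} = A \<inter> {\<omega> \<in> space M. X t \<omega> = \<beta> a}" for a
      using A by auto
    then show "(\<lambda>a. {\<omega> \<in> A. X t \<omega> = \<beta> a}) ` {..<L} \<subseteq> sets M"
      using assms X_eq_sets by auto
    show "disjoint_family_on (\<lambda>a. {\<omega> \<in> A. X t \<omega> = \<beta> a}) {..<L}"
      using inj by (auto simp: disjoint_family_on_def inj_on_def)
  qed simp
  ultimately show ?thesis by simp
qed

text \<open>Total probability over the value at time \<open>r\<close>. No membership condition on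
  \<open>i\<close> appears because \<open>word_prob r\<close> reads only the positions below
  \<open>r\<close>.\<close>

lemma sum_word_prob_snoc: "(\<Sum>a<L. word_prob (Suc r) (i(r := a))) = word_prob r i"
proof -
  let ?A = "{\<omega> \<in> space M. \<forall>k<r. X k \<omega> = \<beta> (i k)}"
  have "word_prob (Suc r) (i(r := a)) = measure M {\<omega> \<in> ?A. X r \<omega> = \<beta> a}" for a
    unfolding word_prob_def block_prob_def
    by (intro arg_cong[where f = "measure M"]) (auto simp: less_Suc_eq)
  then have "(\<Sum>a<L. word_prob (Suc r) (i(r := a))) = (\<Sum>a<L. measure M {\<omega> \<in> ?A. X r \<omega> = \<beta> a})"
    by (simp only:)
  also have "\<dots> = measure M ?A"
    using block_event_sets[of r 0] by (intro measure_split_value) simp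
  finally show ?thesis
    by (simp add: word_prob_def block_prob_def)
qed

text \<open>Summing out the value at time 0 leaves a block that starts at time 1. This is where
  invariance under time shifts enters the argument.\<close>

lemma sum_word_prob_cons: "(\<Sum>a<L. word_prob (Suc r) (case_nat a i)) = word_prob r i"
proof -
  let ?A = "{\<omega> \<in> space M. \<forall>k<r. X (k + 1) \<omega> = \<beta> (i k)}"
  have "word_prob (Suc r) (case_nat a i) = measure M {\<omega> \<in> ?A. X 0 \<omega> = \<beta> a}" for a
    unfolding word_prob_def block_prob_def
    by (intro arg_cong[where f = "measure M"]) (auto simp: less_Suc_eq_0_disj)
  then have "(\<Sum>a<L. word_prob (Suc r) (case_nat a i)) = (\<Sum>a<L. measure M {\<omega> \<in> ?A. X 0 \<omega> = \<beta> a})"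
    by (simp only:)
  also have "\<dots> = measure M ?A"
    by (intro measure_split_value block_event_sets)
  also have "\<dots> = word_prob r i"
    unfolding word_prob_def by (rule block_prob_shift[OF stationary])
  finally show ?thesis .
qed

lemma word_prob_0: "word_prob 0 i = 1"
  by (simp add: word_prob_def block_prob_def prob_space)

lemma sum_word_prob: "(\<Sum>i\<in>{..<r} \<rightarrow>\<^sub>E {..<L}. word_prob r i) = 1"
  by (induction r) (simp_all add: word_prob_0 sum_PiE_snoc sum_word_prob_snoc)

section \<open>Monotonicity, growth and concavity of the block entropy\<close>

text \<open>The separate convention for length 0 agrees with the general formula: the only term
  belongs to the empty word and is \<open>1 * ln 1 = 0\<close>. The inequalities below therefore
  need no case distinction.\<close>

lemma block_entropy_eq:
  "block_entropy M X \<beta> L r = - (\<Sum>i\<in>{..<r} \<rightarrow>\<^sub>E {..<L}. word_prob r i * ln (word_prob r i))"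
  by (cases "r = 0") (simp_all add: block_entropy_def word_prob_0 flip: word_prob_def)

text \<open>For each prefix \<open>i\<close>, the probabilities of its one-letter extensions add up
  to that of \<open>i\<close>, so \<open>sum_mult_ln_le_sum\<close> applies prefix by
  prefix.\<close>

lemma block_entropy_mono: "block_entropy M X \<beta> L r \<le> block_entropy M X \<beta> L (Suc r)"
proof -
  have "(\<Sum>a<L. word_prob (Suc r) (i(r := a)) * ln (word_prob (Suc r) (i(r := a))))
      \<le> word_prob r i * ln (word_prob r i)" for i
    using sum_mult_ln_le_sum[of "{..<L}" "\<lambda>a. word_prob (Suc r) (i(r := a))"]
    by (simp add: word_prob_nonneg sum_word_prob_snoc)
  then show ?thesis
    by (simp add: block_entropy_eq sum_PiE_snoc sum_mono)
qed

lemma block_entropy_Suc_le: "block_entropy M X \<beta> L (Suc r) \<le> block_entropy M X \<beta> L r + ln (real L)"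
proof -
  let ?W = "{..<r} \<rightarrow>\<^sub>E {..<L}"
  have "word_prob r i * ln (word_prob r i)
      \<le> (\<Sum>a<L. word_prob (Suc r) (i(r := a)) * ln (word_prob (Suc r) (i(r := a))))
        + word_prob r i * ln (real L)" for i
    using sum_mult_ln_ge_uniform[of "{..<L}" "\<lambda>a. word_prob (Suc r) (i(r := a))"]
    by (simp add: word_prob_nonneg sum_word_prob_snoc)
  then have "(\<Sum>i\<in>?W. word_prob r i * ln (word_prob r i))
      \<le> (\<Sum>i\<in>?W. (\<Sum>a<L. word_prob (Suc r) (i(r := a)) * ln (word_prob (Suc r) (i(r := a))))
        + word_prob r i * ln (real L))"
    by (rule sum_mono)
  \<comment> \<open>The terms \<open>word_prob r i * ln (real L)\<close> add up to
    \<open>ln (real L)\<close> because the prefix probabilities sum to 1.\<close>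
  also have "\<dots> = (\<Sum>i\<in>?W. \<Sum>a<L. word_prob (Suc r) (i(r := a)) * ln (word_prob (Suc r) (i(r := a))))
      + ln (real L)"
    by (simp add: sum.distrib sum_word_prob flip: sum_distrib_right)
  finally show ?thesis
    by (simp add: block_entropy_eq sum_PiE_snoc)
qed

text \<open>For a fixed middle word \<open>i\<close>, the probabilities of the words
  \<open>a i b\<close> form a matrix in \<open>a\<close> and \<open>b\<close>. Its row sums belong
  to the words \<open>a i\<close>, its column sums to the words \<open>i b\<close>, and its total to
  \<open>i\<close>; \<open>sum_mult_ln_le_joint\<close> is applied to it and the result summed over
  \<open>i\<close>.\<close>

lemma block_entropy_concave:
  "block_entropy M X \<beta> L (Suc (Suc u)) + block_entropy M X \<beta> L u \<le> 2 * block_entropy M X \<beta> L (Suc u)"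
proof -
  let ?W = "{..<u} \<rightarrow>\<^sub>E {..<L}"
  let ?g = "\<lambda>r i. word_prob r i * ln (word_prob r i)"
  let ?f = "\<lambda>i a b. (case_nat a i)(Suc u := b)"
  have R: "(\<Sum>b<L. word_prob (Suc (Suc u)) (?f i a b)) = word_prob (Suc u) (case_nat a i)" for i a
    by (rule sum_word_prob_snoc)
  have C: "(\<Sum>a<L. word_prob (Suc (Suc u)) (?f i a b)) = word_prob (Suc u) (i(u := b))" for i b
    by (simp add: sum_word_prob_cons flip: case_nat_fun_upd)
  have "(\<Sum>a<L. ?g (Suc u) (case_nat a i)) + (\<Sum>b<L. ?g (Suc u) (i(u := b)))
      \<le> (\<Sum>a<L. \<Sum>b<L. ?g (Suc (Suc u)) (?f i a b)) + ?g u i" for i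
    using sum_mult_ln_le_joint[of "{..<L}" "{..<L}" "\<lambda>a b. word_prob (Suc (Suc u)) (?f i a b)"]
    by (simp add: word_prob_nonneg R C sum_word_prob_cons)
  then have "(\<Sum>i\<in>?W. (\<Sum>a<L. ?g (Suc u) (case_nat a i)) + (\<Sum>b<L. ?g (Suc u) (i(u := b))))
      \<le> (\<Sum>i\<in>?W. (\<Sum>a<L. \<Sum>b<L. ?g (Suc (Suc u)) (?f i a b)) + ?g u i)"
    by (rule sum_mono)
  moreover have "(\<Sum>i\<in>?W. \<Sum>a<L. ?g (Suc u) (case_nat a i)) = - block_entropy M X \<beta> L (Suc u)"
    by (simp add: block_entropy_eq sum_PiE_cons)
  moreover have "(\<Sum>i\<in>?W. \<Sum>b<L. ?g (Suc u) (i(u := b))) = - block_entropy M X \<beta> L (Suc u)"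
    by (simp add: block_entropy_eq sum_PiE_snoc)
  moreover have "(\<Sum>i\<in>?W. \<Sum>a<L. \<Sum>b<L. ?g (Suc (Suc u)) (?f i a b))
      = - block_entropy M X \<beta> L (Suc (Suc u))"
    \<comment> \<open>The last letter is split off first, then the first letter of the remaining
      prefix. The lengths are fixed so that each rule fires at its intended level.\<close>
    by (simp only: block_entropy_eq sum_PiE_snoc[of _ "Suc u"] sum_PiE_cons[of _ u] minus_minus)
  moreover have "(\<Sum>i\<in>?W. ?g u i) = - block_entropy M X \<beta> L u"
    by (simp add: block_entropy_eq)
  ultimately show ?thesis
    by (simp add: sum.distrib)
qed

end

theorem proposition3:
  fixes M :: "'w measure" and X :: "nat \<Rightarrow> 'w \<Rightarrow> 'b" and \<beta> :: "nat \<Rightarrow> 'b" and L :: nat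
  assumes "prob_space M"
    and "inj_on \<beta> {..<L}"
    and "stationary_process M (count_space (\<beta> ` {..<L})) X"
  shows "\<forall>u. 0 \<le> predictability_gain M X \<beta> L u \<and> predictability_gain M X \<beta> L u \<le> ln (real L)"
proof
  fix u
  interpret stationary_finite_process M X \<beta> L
    using assms by (simp add: stationary_finite_process_def stationary_finite_process_axioms_def)
  show "0 \<le> predictability_gain M X \<beta> L u \<and> predictability_gain M X \<beta> L u \<le> ln (real L)"
    using block_entropy_concave[of u] block_entropy_mono[of "Suc u"] block_entropy_Suc_le[of u]
    by (simp add: predictability_gain_def)
qed

end
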